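(* Let $(P,Q)$ and $(R,S)$ be two commuting Rota-Baxter systems on an associative algebra $A$. Then $(A,\nwarrow,\nearrow,\swarrow,\searrow)$ is a quadri-algebra, where $$a\nwarrow b=a\,QS(b),\quad a\nearrow b=P(a)S(b),\quad a\swarrow b=R(a)Q(b),\quad a\searrow b=PR(a)\,b.$$
   Context: All vector spaces are over a field of characteristic zero. A Rota-Baxter system on an associative algebra $A$ is a pair of linear maps $R,S:A\to A$ with $R(a)R(b)=R(R(a)b+aS(b))$ and $S(a)S(b)=S(R(a)b+aS(b))$ for all $a,b\in A$. Two Rota-Baxter systems $(P,Q)$ and $(R,S)$ on $A$ commute if $P\circ R=R\circ P$, $P\circ S=S\circ P$, $Q\circ R=R\circ Q$, $Q\circ S=S\circ Q$. A quadri-algebra is a vector space with four bilinear operations $\nwarrow,\nearrow,\swarrow,\searrow$ such that, writing $a\sqsubset b=a\nwarrow b+a\swarrow b$, $a\sqsupset b=a\nearrow b+a\searrow b$, $a\wedge b=a\nwarrow b+a\nearrow b$, $a\vee b=a\swarrow b+a\searrow b$, and $a*b$ for the sum of all four, the following nine identities hold: \begin{align*} &(a\nwarrow b)\nwarrow c=a\nwarrow(b*c),&&(a\nearrow b)\nwarrow c=a\nearrow(b\sqsubset c),&&(a\wedge b)\nearrow c=a\nearrow(b\sqsupset c),\\ &(a\swarrow b)\nwarrow c=a\swarrow(b\wedge c),&&(a\searrow b)\nwarrow c=a\searrow(b\nwarrow c),&&(a\vee b)\nearrow c=a\searrow(b\nearrow c),\\ &(a\sqsubset b)\swarrow c=a\swarrow(b\vee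 c),&&(a\sqsupset b)\swarrow c=a\searrow(b\swarrow c),&&(a*b)\searrow c=a\searrow(b\searrow c). \end{align*} *)

theory Defs
  imports Complex_Main
begin

text \<open>Algebras are not assumed to be unital: the class \<^class>\<open>ring\<close> provides an associative,
  biadditive multiplication without a unit.\<close>

locale assoc_algebra = vector_space scale
  for scale :: "'k::field_char_0 \<Rightarrow> 'a::ring \<Rightarrow> 'a" +
  assumes scale_mult_left: "scale c a * b = scale c (a * b)"
    and scale_mult_right: "a * scale c b = scale c (a * b)"

locale rota_baxter_system = assoc_algebra scale
  for scale :: "'k::field_char_0 \<Rightarrow> 'a::ring \<Rightarrow> 'a" +
  fixes R S :: "'a \<Rightarrow> 'a"
  assumes linear_R: "Vector_Spaces.linear scale scale R"
    and linear_S: "Vector_Spaces.linear scale scale S"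
    and R_mult: "R a * R b = R (R a * b + a * S b)"
    and S_mult: "S a * S b = S (R a * b + a * S b)"

definition systems_commute ::
    "('a \<Rightarrow> 'a) \<Rightarrow> ('a \<Rightarrow> 'a) \<Rightarrow> ('a \<Rightarrow> 'a) \<Rightarrow> ('a \<Rightarrow> 'a) \<Rightarrow> bool"
  where "systems_commute P Q R S \<longleftrightarrow>
    P \<circ> R = R \<circ> P \<and> P \<circ> S = S \<circ> P \<and> Q \<circ> R = R \<circ> Q \<and> Q \<circ> S = S \<circ> Q"

definition bilinear_op ::
    "('k::field \<Rightarrow> 'a::ab_group_add \<Rightarrow> 'a) \<Rightarrow> ('a \<Rightarrow> 'a \<Rightarrow> 'a) \<Rightarrow> bool"
  where "bilinear_op scale f \<longleftrightarrow>
    (\<forall>a. Vector_Spaces.linear scale scale (\<lambda>b. f a b)) \<and>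
    (\<forall>b. Vector_Spaces.linear scale scale (\<lambda>a. f a b))"

text \<open>The four operations are ordered north-west, north-east, south-west, south-east.
  The composite operations are local definitions, so the locale predicate takes only
  \<open>scale\<close> and these four operations.  Here \<open>\<triangle>\<close>, \<open>\<nabla>\<close>, \<open>\<star>\<close> stand for the usual wedge, vee and
  asterisk, which are taken by conjunction, disjunction and the ring product.\<close>

locale quadri_algebra = vector_space scale
  for scale :: "'k::field_char_0 \<Rightarrow> 'a::ab_group_add \<Rightarrow> 'a" +
  fixes nw :: "'a \<Rightarrow> 'a \<Rightarrow> 'a" (infixl "\<nwarrow>" 70)
    and ne :: "'a \<Rightarrow> 'a \<Rightarrow> 'a" (infixl "\<nearrow>" 70)
    and sw :: "'a \<Rightarrow> 'a \<Rightarrow> 'a" (infixl "\<swarrow>" 70)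
    and se :: "'a \<Rightarrow> 'a \<Rightarrow> 'a" (infixl "\<searrow>" 70)
    and west :: "'a \<Rightarrow> 'a \<Rightarrow> 'a" (infixl "\<sqsubset>" 70)
    and east :: "'a \<Rightarrow> 'a \<Rightarrow> 'a" (infixl "\<sqsupset>" 70)
    and north :: "'a \<Rightarrow> 'a \<Rightarrow> 'a" (infixl "\<triangle>" 70)
    and south :: "'a \<Rightarrow> 'a \<Rightarrow> 'a" (infixl "\<nabla>" 70)
    and total :: "'a \<Rightarrow> 'a \<Rightarrow> 'a" (infixl "\<star>" 70)
  defines "a \<sqsubset> b \<equiv> a \<nwarrow> b + a \<swarrow> b"
    and "a \<sqsupset> b \<equiv> a \<nearrow> b + a \<searrow> b"
    and "a \<triangle> b \<equiv> a \<nwarrow> b + a \<nearrow> b"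
    and "a \<nabla> b \<equiv> a \<swarrow> b + a \<searrow> b"
    and "a \<star> b \<equiv> a \<nwarrow> b + a \<nearrow> b + a \<swarrow> b + a \<searrow> b"
  assumes bilinear_nw: "bilinear_op scale (\<nwarrow>)"
    and bilinear_ne: "bilinear_op scale (\<nearrow>)"
    and bilinear_sw: "bilinear_op scale (\<swarrow>)"
    and bilinear_se: "bilinear_op scale (\<searrow>)"
    and nw_nw: "(a \<nwarrow> b) \<nwarrow> c = a \<nwarrow> (b \<star> c)"
    and ne_nw: "(a \<nearrow> b) \<nwarrow> c = a \<nearrow> (b \<sqsubset> c)"
    and north_ne: "(a \<triangle> b) \<nearrow> c = a \<nearrow> (b \<sqsupset> c)"
    and sw_nw: "(a \<swarrow> b) \<nwarrow> c = a \<swarrow> (b \<triangle> c)"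
    and se_nw: "(a \<searrow> b) \<nwarrow> c = a \<searrow> (b \<nwarrow> c)"
    and south_ne: "(a \<nabla> b) \<nearrow> c = a \<searrow> (b \<nearrow> c)"
    and west_sw: "(a \<sqsubset> b) \<swarrow> c = a \<swarrow> (b \<nabla> c)"
    and east_sw: "(a \<sqsupset> b) \<swarrow> c = a \<searrow> (b \<swarrow> c)"
    and total_se: "(a \<star> b) \<searrow> c = a \<searrow> (b \<searrow> c)"

end

theory Submission
  imports Defs
begin

text \<open>Each identity combines one of the four product formulas with commutativity. In the
  identities for \<open>a \<nwarrow> b \<nwarrow> c\<close> and \<open>a \<searrow> b \<searrow> c\<close> two formulas are
  nested: the composites \<open>Q \<circ> S\<close> and \<open>P \<circ> R\<close> send the sum of all four operations to
  the product of \<open>A\<close>.\<close>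

context assoc_algebra
begin

lemma linear_mult_left: "Vector_Spaces.linear scale scale (\<lambda>b. a * b)"
  by unfold_locales (simp_all add: algebra_simps scale_mult_right)

lemma linear_mult_right: "Vector_Spaces.linear scale scale (\<lambda>a. a * b)"
  by unfold_locales (simp_all add: algebra_simps scale_mult_left)

text \<open>All four operations have this shape, with the identity as one factor for
  \<open>a * Q (S b)\<close> and \<open>P (R a) * b\<close>, so bilinearity is settled once.\<close>

lemma bilinear_op_mult_comp:
  assumes f: "Vector_Spaces.linear scale scale f" and g: "Vector_Spaces.linear scale scale g"
  shows "bilinear_op scale (\<lambda>a b. f a * g b)"
  unfolding bilinear_op_def
  using Vector_Spaces.linear_compose[OF g linear_mult_left]
    Vector_Spaces.linear_compose[OF f linear_mult_right]
  by (simp add: comp_def)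

end

theorem proposition7p5:
  fixes scale :: "'k::field_char_0 \<Rightarrow> 'a::ring \<Rightarrow> 'a"
    and P Q R S :: "'a \<Rightarrow> 'a"
  assumes "assoc_algebra scale"
    and "rota_baxter_system scale P Q"
    and "rota_baxter_system scale R S"
    and "systems_commute P Q R S"
  shows "quadri_algebra scale
    (\<lambda>a b. a * Q (S b))
    (\<lambda>a b. P a * S b)
    (\<lambda>a b. R a * Q b)
    (\<lambda>a b. P (R a) * b)"
proof -
  interpret assoc_algebra scale by fact
  interpret PQ: rota_baxter_system scale P Q by fact
  interpret RS: rota_baxter_system scale R S by fact
  \<comment> \<open>Oriented as rewrite rules: every mixed composite is brought to the form with
    \<open>P\<close> or \<open>Q\<close> outermost.\<close>
  have comm: "R (P x) = P (R x)" "S (P x) = P (S x)" "R (Q x) = Q (R x)" "S (Q x) = Q (S x)" for x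
    using assms(4) by (simp_all add: systems_commute_def fun_eq_iff)
  have add: "P (x + y) = P x + P y" "Q (x + y) = Q x + Q y"
    "R (x + y) = R x + R y" "S (x + y) = S x + S y" for x y
    using PQ.linear_R PQ.linear_S RS.linear_R RS.linear_S
    by (simp_all add: Vector_Spaces.linear.axioms module_hom.add Vector_Spaces.linear_iff_module_hom)
  have PQm: "P (P x * y) + P (x * Q y) = P x * P y" "Q (P x * y) + Q (x * Q y) = Q x * Q y" for x y
    using PQ.R_mult[of x y] PQ.S_mult[of x y] by (simp_all add: add)
  have RSm: "R (R x * y) + R (x * S y) = R x * R y" "S (R x * y) + S (x * S y) = S x * S y" for x y
    using RS.R_mult[of x y] RS.S_mult[of x y] by (simp_all add: add)
  have QS: "Q (S (x * Q (S y) + P x * S y + R x * Q y + P (R x) * y)) = Q (S x) * Q (S y)" for x y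
  proof -
    \<comment> \<open>The four summands split into the pairs of the \<open>S\<close> formula at
      \<open>(P x, y)\<close> and at \<open>(x, Q y)\<close>. The two resulting products add up to
      the argument of the \<open>Q\<close> formula at \<open>(S x, S y)\<close>.\<close>
    have "S (x * Q (S y) + P x * S y + R x * Q y + P (R x) * y)
        = (S (R (P x) * y) + S (P x * S y)) + (S (R x * Q y) + S (x * S (Q y)))"
      by (simp add: add comm algebra_simps)
    also have "\<dots> = P (S x) * S y + S x * Q (S y)"
      using RSm(2)[of "P x" y] RSm(2)[of x "Q y"] by (simp only: comm)
    finally show ?thesis by (simp add: add PQm)
  qed
  have PR: "P (R (x * Q (S y) + P x * S y + R x * Q y + P (R x) * y)) = P (R x) * P (R y)" for x y
  proof -
    \<comment> \<open>The same pairing for \<open>R\<close> leaves the argument of the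
      \<open>P\<close> formula at \<open>(R x, R y)\<close>.\<close>
    have "R (x * Q (S y) + P x * S y + R x * Q y + P (R x) * y)
        = (R (R (P x) * y) + R (P x * S y)) + (R (R x * Q y) + R (x * S (Q y)))"
      by (simp add: add comm algebra_simps)
    also have "\<dots> = P (R x) * R y + R x * Q (R y)"
      using RSm(1)[of "P x" y] RSm(1)[of x "Q y"] by (simp only: comm)
    finally show ?thesis by (simp add: add PQm)
  qed
  \<comment> \<open>The summands stand in the order produced by the composite operations, so that
    these equations match syntactically.\<close>
  have Pm: "P (x * Q y + P x * y) = P x * P y" "Q (x * Q y + P x * y) = Q x * Q y"
    and Rm: "R (x * S y + R x * y) = R x * R y" "S (x * S y + R x * y) = S x * S y" for x y
    using PQm[of x y] RSm[of x y] by (simp_all add: add add.commute)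
  have id: "Vector_Spaces.linear scale scale (\<lambda>x. x)"
    by (rule linear_ident)
  have QS_linear: "Vector_Spaces.linear scale scale (\<lambda>x. Q (S x))"
    using Vector_Spaces.linear_compose[OF RS.linear_S PQ.linear_S] by (simp add: comp_def)
  have PR_linear: "Vector_Spaces.linear scale scale (\<lambda>x. P (R x))"
    using Vector_Spaces.linear_compose[OF RS.linear_R PQ.linear_R] by (simp add: comp_def)
  note bilin = bilinear_op_mult_comp[OF id QS_linear] bilinear_op_mult_comp[OF PQ.linear_R RS.linear_S]
    bilinear_op_mult_comp[OF RS.linear_R PQ.linear_S] bilinear_op_mult_comp[OF PR_linear id]
  show ?thesis
  proof unfold_locales
    fix a b c
    show "a * Q (S b) * Q (S c) = a * Q (S (b * Q (S c) + P b * S c + R b * Q c + P (R b) * c))"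
      by (simp only: QS mult.assoc)
    \<comment> \<open>Here \<open>Rm\<close> needs an explicit instance: its \<open>S (Q c)\<close>
      appears in the goal as \<open>Q (S c)\<close>, so the instance is first normalised by
      \<open>comm\<close>.\<close>
    show "P a * S b * Q (S c) = P a * S (b * Q (S c) + R b * Q c)"
      using Rm(2)[of b "Q c"] by (simp only: comm mult.assoc)
    show "P (a * Q (S b) + P a * S b) * S c = P a * S (P b * S c + P (R b) * c)"
      using Rm(2)[of "P b" c] by (simp only: Pm comm mult.assoc)
    show "R a * Q b * Q (S c) = R a * Q (b * Q (S c) + P b * S c)"
      by (simp only: Pm mult.assoc)
    show "P (R a) * b * Q (S c) = P (R a) * (b * Q (S c))"
      by (rule mult.assoc)
    show "P (R a * Q b + P (R a) * b) * S c = P (R a) * (P b * S c)"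
      by (simp only: Pm mult.assoc)
    show "R (a * Q (S b) + R a * Q b) * Q c = R a * Q (R b * Q c + P (R b) * c)"
      using Rm(1)[of a "Q b"] by (simp only: Pm comm mult.assoc)
    \<comment> \<open>The \<open>R\<close> formula at \<open>(P a, b)\<close>, whose
      \<open>R (P a)\<close> is turned into \<open>P (R a)\<close>.\<close>
    show "R (P a * S b + P (R a) * b) * Q c = P (R a) * (R b * Q c)"
      using Rm(1)[of "P a" b] by (simp only: comm mult.assoc)
    show "P (R (a * Q (S b) + P a * S b + R a * Q b + P (R a) * b)) * c = P (R a) * (P (R b) * c)"
      by (simp only: PR mult.assoc)
  qed (fact bilin)+
qed

end
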